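(* Let $\mathfrak F$ be a countable field and let $E$ be an $\mathfrak F$-vector space with a countably infinite basis $(e_n)_{n\in\mathbb N}$. Then every analytic subset $\mathbb A\subseteq E^\infty$ is strategically Ramsey; that is, for every infinite-dimensional block subspace $V\subseteq E$ and every finite block sequence $\vec z$ there is an infinite-dimensional block subspace $W\subseteq V$ such that either (a) player II has a strategy in Gowers' game $G_W(\vec z)$ to play in $\mathbb A$, or (b) player I has a strategy in the infinite asymptotic game $F_W(\vec z)$ to play in $E^\infty\setminus\mathbb A$.
   Context: $E$ carries the discrete topology and $E^\infty=E^{\mathbb N}$ the product topology (a Polish space); "analytic" refers to this topology. For $x=\sum a_ne_n\in E$, $\operatorname{supp}x=\{n: a_n\neq0\}$. For non-zero $x,y\in E$, $x<y$ means $n<m$ for all $n\in\operatorname{supp}x$, $m\in\operatorname{supp}y$; for $k\in\mathbb N$, $k<x$ means $k<n$ for all $n\in\operatorname{supp}x$. A (finite, possibly empty, or infinite) sequence $(x_0,x_1,\ldots)$ of non-zero vectors is a block sequence if $x_n<x_{n+1}$ for all $n$. An (infinite-dimensional) block subspace is a subspace spanned by an infinite block sequence. Let $X\subseteq E$ be an infinite-dimensional block subspace and $\vec x$ a finite block sequence. Gowers' game $G_X(\vec x)$: players I and II alternate, I beginning. In round $i$, I plays an infinite-dimensional block subspace $Y_i\subseteq X$, then II plays a non-zero vector $x_i\in Y_i$, subject to $x_0<x_1<x_2<\cdots$. The outcome is the concatenation $\vec x{}^\frown(x_0,x_1,x_2,\ldots)$. Infinite asymptotic game $F_X(\vec x)$: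 I and II alternate, I beginning. In round $i$, I plays a natural number $n_i$, then II plays a non-zero vector $x_i\in X$ with $n_i<x_i$, subject to $n_0<n_1<\cdots$ and $x_0<x_1<\cdots$. The outcome is $\vec x{}^\frown(x_0,x_1,x_2,\ldots)$. A player "has a strategy to play in" a set $\mathbb A\subseteq E^\infty$ if he has a strategy ensuring that the outcome lies in $\mathbb A$. *)

theory Defs
  imports "HOL-Analysis.Analysis" "HOL-Library.Omega_Words_Fun"
begin

definition discrete_sequence_space :: "(nat \<Rightarrow> 'a) topology" where
  "discrete_sequence_space = product_topology (\<lambda>_. discrete_topology UNIV) UNIV"

text \<open>The domain of \<open>f\<close> below is Baire space. It has no empty continuous image,
  so the empty set is admitted separately.\<close>

definition analytic_set_in :: "'a topology \<Rightarrow> 'a set \<Rightarrow> bool" where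
  "analytic_set_in X A \<longleftrightarrow> A \<subseteq> topspace X \<and>
     (A = {} \<or> (\<exists>f :: (nat \<Rightarrow> nat) \<Rightarrow> 'a.
        continuous_map discrete_sequence_space X f \<and> f ` topspace discrete_sequence_space = A))"

locale vector_space_with_basis = vector_space scale
  for scale :: "'f::field \<Rightarrow> 'e::ab_group_add \<Rightarrow> 'e" +
  fixes e :: "nat \<Rightarrow> 'e"
  assumes inj_basis: "inj e"
    and independent_basis: "independent (range e)"
    and span_basis: "span (range e) = UNIV"
begin

definition supp :: "'e \<Rightarrow> nat set" where
  "supp x = {n. representation (range e) x (e n) \<noteq> 0}"

text \<open>The two relations below hold vacuously for the zero vector; wherever they are used,
  the vectors are separately required to be non-zero.\<close>

definition vec_less :: "'e \<Rightarrow> 'e \<Rightarrow> bool" where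
  "vec_less x y \<longleftrightarrow> (\<forall>n\<in>supp x. \<forall>m\<in>supp y. n < m)"

definition nat_less_vec :: "nat \<Rightarrow> 'e \<Rightarrow> bool" where
  "nat_less_vec k x \<longleftrightarrow> (\<forall>n\<in>supp x. k < n)"

definition block_seq :: "(nat \<Rightarrow> 'e) \<Rightarrow> bool" where
  "block_seq x \<longleftrightarrow> (\<forall>n. x n \<noteq> 0) \<and> (\<forall>n. vec_less (x n) (x (Suc n)))"

definition finite_block_seq :: "'e list \<Rightarrow> bool" where
  "finite_block_seq xs \<longleftrightarrow> (\<forall>n < length xs. xs ! n \<noteq> 0) \<and>
     (\<forall>n. Suc n < length xs \<longrightarrow> vec_less (xs ! n) (xs ! Suc n))"

text \<open>A block sequence is linearly independent, so the spans of infinite ones are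
  automatically infinite-dimensional.\<close>

definition block_subspace :: "'e set \<Rightarrow> bool" where
  "block_subspace X \<longleftrightarrow> (\<exists>x. block_seq x \<and> X = span (range x))"

text \<open>A strategy is a function of the moves the opponent has made so far. In round \<open>i\<close>,
  player II has seen the opponent's moves of rounds \<open>0, \<dots>, i\<close> and player I those of
  rounds \<open>0, \<dots>, i - 1\<close>. The vectors played need not lie beyond the initial sequence.\<close>

definition II_has_strategy_Gowers :: "'e set \<Rightarrow> 'e list \<Rightarrow> (nat \<Rightarrow> 'e) set \<Rightarrow> bool" where
  "II_has_strategy_Gowers X xs A \<longleftrightarrow>
     (\<exists>\<sigma> :: 'e set list \<Rightarrow> 'e. \<forall>Y :: nat \<Rightarrow> 'e set.
        (\<forall>i. block_subspace (Y i) \<and> Y i \<subseteq> X) \<longrightarrow>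
        (let x = (\<lambda>i. \<sigma> (map Y [0..<Suc i])) in
           (\<forall>i. x i \<noteq> 0 \<and> x i \<in> Y i \<and> vec_less (x i) (x (Suc i))) \<and>
           conc xs x \<in> A))"

text \<open>Player I must also keep to the rules, that is, play increasing numbers. It suffices to
  quantify over infinite runs: whatever numbers I plays, II can continue any finite legal
  run.\<close>

definition I_has_strategy_asymptotic :: "'e set \<Rightarrow> 'e list \<Rightarrow> (nat \<Rightarrow> 'e) set \<Rightarrow> bool" where
  "I_has_strategy_asymptotic X xs A \<longleftrightarrow>
     (\<exists>\<sigma> :: 'e list \<Rightarrow> nat. \<forall>x :: nat \<Rightarrow> 'e.
        let n = (\<lambda>i. \<sigma> (map x [0..<i])) in
          (\<forall>i. x i \<noteq> 0 \<and> x i \<in> X \<and> nat_less_vec (n i) (x i) \<and> vec_less (x i) (x (Suc i))) \<longrightarrow>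
          (\<forall>i. n i < n (Suc i)) \<and> conc xs x \<in> A)"

definition strategically_Ramsey :: "(nat \<Rightarrow> 'e) set \<Rightarrow> bool" where
  "strategically_Ramsey A \<longleftrightarrow>
     (\<forall>V z. block_subspace V \<and> finite_block_seq z \<longrightarrow>
        (\<exists>W. block_subspace W \<and> W \<subseteq> V \<and>
           (II_has_strategy_Gowers W z A \<or> I_has_strategy_asymptotic W z (UNIV - A))))"

end

end

theory Submission
  imports Defs
begin

text \<open>Write \<open>A\<close> as the image of Baire space under a continuous map \<open>f\<close>, and let \<open>A s\<close> be the image of the
  sequences extending \<open>s\<close>. Diagonalising over the countably many positions \<open>p\<close> and nodes \<open>s\<close> gives a
  block subspace \<open>X\<close> such that, at every position, either player I can avoid \<open>A s\<close> in the asymptotic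
  game on \<open>X\<close> or he cannot do so in any block subspace of \<open>X\<close>; in the second case call \<open>p\<close> bad for \<open>s\<close>.

  If \<open>p\<close> is bad for \<open>s\<close>, then player II can force Gowers' game on a further subspace \<open>W\<close> from \<open>p\<close> to a
  position that is bad for some child of \<open>s\<close>. Otherwise, by the dichotomy for open games, player I
  could stay in the asymptotic game among positions from which player II cannot do this. These are
  bad for no child of \<open>s\<close>, so strategies against all the \<open>A (s @ [n])\<close> are available there (against
  the \<open>n\<close>-th one from round \<open>n\<close> on, so that only finitely many are in use at any time);
  running them in parallel, player I would avoid \<open>A s\<close>. If the initial position is bad for the root,
  player II therefore wins by moving from bad position to bad position along a branch \<open>\<alpha>\<close>: each
  position passed has an extension in \<open>A s\<close> for the current initial segment \<open>s\<close> of \<open>\<alpha>\<close>, so by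
  continuity the outcome is \<open>f \<alpha>\<close>.\<close>

section \<open>The games over an abstract space of moves\<close>

text \<open>\<open>P\<close> stands for the block subspaces, \<open>U n\<close> for the non-zero
  vectors supported beyond \<open>n\<close>, and \<open>ok q y\<close> for legality of the move
  \<open>y\<close> at the position \<open>q\<close>. \<open>refine\<close> and \<open>fuse\<close>
  are the closure properties that diagonal arguments use; \<open>eventually_ok\<close> makes every
  vector far enough out a legal move.\<close>

locale gowers_space =
  fixes P :: "'a set set"
    and U :: "nat \<Rightarrow> 'a set"
    and ok :: "'a list \<Rightarrow> 'a \<Rightarrow> bool"
  assumes countable_points: "countable (UNIV :: 'a set)"
    and U_antimono: "\<And>m n. m \<le> n \<Longrightarrow> U n \<subseteq> U m"
    and refine: "\<And>X Y N. X \<in> P \<Longrightarrow> Y \<in> P \<Longrightarrow> Y \<inter> U N \<subseteq> X \<Longrightarrow> \<exists>Z\<in>P. Z \<subseteq> X \<inter> Y"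
    and fuse: "\<And>X :: nat \<Rightarrow> 'a set. (\<And>n. X n \<in> P) \<Longrightarrow> (\<And>n. X (Suc n) \<subseteq> X n) \<Longrightarrow>
      \<exists>Y\<in>P. Y \<subseteq> X 0 \<and> (\<forall>n. \<exists>N. Y \<inter> U N \<subseteq> X n)"
    and eventually_ok: "\<And>q. \<exists>N. U N \<subseteq> {y. ok q y}"
begin

section \<open>Almost inclusion and diagonalisation\<close>

definition almost_le :: "'a set \<Rightarrow> 'a set \<Rightarrow> bool" where
  "almost_le Y X \<longleftrightarrow> (\<exists>N. Y \<inter> U N \<subseteq> X)"

lemma almost_le_subset: "Y \<subseteq> X \<Longrightarrow> almost_le Y X"
  unfolding almost_le_def by blast

lemma almost_le_trans:
  assumes "almost_le Z Y" "almost_le Y X"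
  shows "almost_le Z X"
proof -
  obtain M N where "Z \<inter> U M \<subseteq> Y" "Y \<inter> U N \<subseteq> X"
    using assms unfolding almost_le_def by blast
  then have "Z \<inter> U (max M N) \<subseteq> X"
    using U_antimono[of M "max M N"] U_antimono[of N "max M N"] by fastforce
  then show ?thesis unfolding almost_le_def by blast
qed

lemma almost_le_refine:
  "X \<in> P \<Longrightarrow> Y \<in> P \<Longrightarrow> almost_le Y X \<Longrightarrow> \<exists>Z\<in>P. Z \<subseteq> X \<and> Z \<subseteq> Y"
  unfolding almost_le_def using refine by (metis Int_subset_iff)

text \<open>Invariance is asked for under almost inclusion because a fusion is only almost contained
  in the stages of its sequence.\<close>

definition hereditary :: "('a set \<Rightarrow> bool) \<Rightarrow> bool" where
  "hereditary Q \<longleftrightarrow> (\<forall>X\<in>P. \<forall>Y\<in>P. almost_le Y X \<longrightarrow> Q X \<longrightarrow> Q Y)"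

lemma hereditaryD: "hereditary Q \<Longrightarrow> X \<in> P \<Longrightarrow> Y \<in> P \<Longrightarrow> almost_le Y X \<Longrightarrow> Q X \<Longrightarrow> Q Y"
  unfolding hereditary_def by blast

text \<open>Requirement number \<open>n\<close> is met at stage \<open>n + 1\<close>; the fusion is
  almost contained in every stage, so heredity hands all requirements down to it.\<close>

lemma fuse_countably_many:
  fixes D :: "'i \<Rightarrow> 'a set \<Rightarrow> bool"
  assumes "countable (UNIV :: 'i set)" and "V \<in> P"
    and her: "\<And>k. hereditary (D k)"
    and dense: "\<And>k X. X \<in> P \<Longrightarrow> X \<subseteq> V \<Longrightarrow> \<exists>Y\<in>P. Y \<subseteq> X \<and> D k Y"
  shows "\<exists>Y\<in>P. Y \<subseteq> V \<and> (\<forall>k. D k Y)"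
proof -
  define d where "d n = D (from_nat_into UNIV n)" for n :: nat
  \<comment> \<open>The first stage is pinned to \<open>V\<close>, since \<open>fuse\<close> gives
    genuine inclusion in stage 0 only.\<close>
  have "\<exists>X. \<forall>n. (X n \<in> P \<and> X n \<subseteq> V \<and> (n = 0 \<longrightarrow> X n = V)) \<and>
      (X (Suc n) \<subseteq> X n \<and> d n (X (Suc n)))"
  proof (rule dependent_nat_choice)
    show "\<exists>X. X \<in> P \<and> X \<subseteq> V \<and> (0 = (0::nat) \<longrightarrow> X = V)" using \<open>V \<in> P\<close> by blast
  next
    fix X and n :: nat
    assume "X \<in> P \<and> X \<subseteq> V \<and> (n = 0 \<longrightarrow> X = V)"
    then show "\<exists>Y. (Y \<in> P \<and> Y \<subseteq> V \<and> (Suc n = 0 \<longrightarrow> Y = V)) \<and> Y \<subseteq> X \<and> d n Y"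
      using dense[of X "from_nat_into UNIV n"] unfolding d_def by fastforce
  qed
  then obtain X where X: "\<And>n. X n \<in> P" "X 0 = V"
    "\<And>n. X (Suc n) \<subseteq> X n" "\<And>n. d n (X (Suc n))" by metis
  obtain Y where Y: "Y \<in> P" "Y \<subseteq> V" "\<And>n. almost_le Y (X n)"
    using fuse[of X, OF X(1) X(3)] X(2) unfolding almost_le_def by metis
  have "D k Y" for k
  proof -
    obtain n where "from_nat_into UNIV n = k"
      using from_nat_into_surj[OF assms(1)] by blast
    then have "D k (X (Suc n))" using X(4)[of n] by (simp add: d_def)
    then show ?thesis using hereditaryD[OF her X(1) Y(1) Y(3)] by blast
  qed
  then show ?thesis using Y by blast
qed

text \<open>Below any \<open>X\<close>, either some subspace satisfies \<open>Q k\<close> or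
  \<open>X\<close> itself rules it out, so decisions are dense; the work lies in their
  heredity.\<close>

lemma decide_countably_many:
  fixes Q :: "'i \<Rightarrow> 'a set \<Rightarrow> bool"
  assumes "countable (UNIV :: 'i set)" and "V \<in> P" and her: "\<And>k. hereditary (Q k)"
  shows "\<exists>Y\<in>P. Y \<subseteq> V \<and> (\<forall>k. Q k Y \<or> (\<forall>Z\<in>P. Z \<subseteq> Y \<longrightarrow> \<not> Q k Z))"
proof (rule fuse_countably_many[OF assms(1,2)])
  fix k
  show "hereditary (\<lambda>Y. Q k Y \<or> (\<forall>Z\<in>P. Z \<subseteq> Y \<longrightarrow> \<not> Q k Z))"
    unfolding hereditary_def
  proof (intro ballI impI)
    fix X Y assume XY: "X \<in> P" "Y \<in> P" "almost_le Y X"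
      and "Q k X \<or> (\<forall>Z\<in>P. Z \<subseteq> X \<longrightarrow> \<not> Q k Z)"
    then consider "Q k X" | "\<forall>Z\<in>P. Z \<subseteq> X \<longrightarrow> \<not> Q k Z" by blast
    then show "Q k Y \<or> (\<forall>Z\<in>P. Z \<subseteq> Y \<longrightarrow> \<not> Q k Z)"
    proof cases
      case 1
      then show ?thesis using hereditaryD[OF her XY] by blast
    next
      case 2
      \<comment> \<open>\<open>Z\<close> need not lie in \<open>X\<close> but is almost contained in
        it; a common refinement would inherit \<open>Q k\<close> inside \<open>X\<close>.\<close>
      have "\<not> Q k Z" if Z: "Z \<in> P" "Z \<subseteq> Y" for Z
      proof
        assume "Q k Z"
        have "almost_le Z X" using almost_le_trans[OF almost_le_subset XY(3)] Z by blast
        then obtain Z' where "Z' \<in> P" "Z' \<subseteq> X" "Z' \<subseteq> Z"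
          using almost_le_refine[OF XY(1) Z(1)] by blast
        then show False
          using hereditaryD[OF her Z(1) _ almost_le_subset \<open>Q k Z\<close>] 2 by blast
      qed
      then show ?thesis by blast
    qed
  qed
next
  fix k X assume "X \<in> P"
  then show "\<exists>Y\<in>P. Y \<subseteq> X \<and> (Q k Y \<or> (\<forall>Z\<in>P. Z \<subseteq> Y \<longrightarrow> \<not> Q k Z))" by blast
qed

text \<open>The asymptotic game, continued from the position \<open>p\<close>. There is no need to demand that the
  vectors increase: player I can enforce it by playing large numbers.\<close>

definition I_avoids :: "'a set \<Rightarrow> 'a list \<Rightarrow> (nat \<Rightarrow> 'a) set \<Rightarrow> bool" where
  "I_avoids X p B \<longleftrightarrow> (\<exists>\<sigma>. \<forall>x. map x [0..<length p] = p \<longrightarrow>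
     (\<forall>i\<ge>length p. x i \<in> X \<inter> U (\<sigma> (map x [0..<i]))) \<longrightarrow> x \<notin> B)"

text \<open>By also playing at least \<open>N\<close>, player I forces the moves made in
  \<open>Y\<close> into \<open>X\<close>, where the old strategy applies.\<close>

lemma hereditary_I_avoids: "hereditary (\<lambda>X. I_avoids X p B)"
  unfolding hereditary_def
proof (intro ballI impI)
  fix X Y assume "almost_le Y X" "I_avoids X p B"
  then obtain N \<sigma> where N: "Y \<inter> U N \<subseteq> X" and
    \<sigma>: "\<And>x. map x [0..<length p] = p \<Longrightarrow>
     (\<And>i. i \<ge> length p \<Longrightarrow> x i \<in> X \<inter> U (\<sigma> (map x [0..<i]))) \<Longrightarrow> x \<notin> B"
    unfolding almost_le_def I_avoids_def by metis
  have sub: "Y \<inter> U (max N (\<sigma> q)) \<subseteq> X \<inter> U (\<sigma> q)" for q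
    using N U_antimono[of N "max N (\<sigma> q)"] U_antimono[of "\<sigma> q" "max N (\<sigma> q)"] by fastforce
  show "I_avoids Y p B"
    unfolding I_avoids_def
  proof (intro exI[of _ "\<lambda>q. max N (\<sigma> q)"] allI impI)
    fix x assume "map x [0..<length p] = p"
      and "\<forall>i\<ge>length p. x i \<in> Y \<inter> U (max N (\<sigma> (map x [0..<i])))"
    then show "x \<notin> B" using \<sigma> sub by blast
  qed
qed

section \<open>Gowers' game with a set of finite positions as target\<close>

definition plays :: "('a set list \<Rightarrow> 'a) \<Rightarrow> (nat \<Rightarrow> 'a set) \<Rightarrow> nat \<Rightarrow> 'a list" where
  "plays g Y n = map (\<lambda>i. g (map Y [0..<Suc i])) [0..<n]"

lemma plays_0 [simp]: "plays g Y 0 = []"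
  by (simp add: plays_def)

lemma map_upt_Suc_shift: "map f [0..<Suc n] = f 0 # map (\<lambda>i. f (Suc i)) [0..<n]"
  by (simp add: upt_conv_Cons map_Suc_upt[symmetric] del: upt_Suc)

lemma plays_Suc:
  "plays g Y (Suc n) = g [Y 0] # plays (\<lambda>Ys. g (Y 0 # Ys)) (\<lambda>i. Y (Suc i)) n"
  unfolding plays_def by (simp add: map_upt_Suc_shift del: upt_Suc)

text \<open>An open game for player II: legality matters only before the round \<open>n\<close> at
  which the target is hit, and \<open>n = 0\<close> is allowed, so a position in \<open>T\<close> is
  already won.\<close>

definition reaches_with ::
    "('a set list \<Rightarrow> 'a) \<Rightarrow> 'a set \<Rightarrow> 'a list set \<Rightarrow> 'a list \<Rightarrow> bool" where
  "reaches_with g X T p \<longleftrightarrow> (\<forall>Y. (\<forall>i. Y i \<in> P \<and> Y i \<subseteq> X) \<longrightarrow>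
     (\<exists>n. p @ plays g Y n \<in> T \<and>
       (\<forall>i<n. g (map Y [0..<Suc i]) \<in> Y i \<and> ok (p @ plays g Y i) (g (map Y [0..<Suc i])))))"

definition II_reaches :: "'a set \<Rightarrow> 'a list set \<Rightarrow> 'a list \<Rightarrow> bool" where
  "II_reaches X T p \<longleftrightarrow> (\<exists>g. reaches_with g X T p)"

lemma II_reaches_target: "p \<in> T \<Longrightarrow> II_reaches X T p"
  unfolding II_reaches_def reaches_with_def by (metis append_Nil2 not_less0 plays_0)

text \<open>Since \<open>p\<close> is outside \<open>T\<close>, no run can stop at
  \<open>n = 0\<close>, so the first reply is a genuine legal move; what remains of \<open>g\<close>
  after \<open>Z\<close> is a strategy from the new position.\<close>

lemma reaches_with_move:
  assumes g: "reaches_with g X T p" and "p \<notin> T" and Z: "Z \<in> P" "Z \<subseteq> X"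
  shows "g [Z] \<in> Z" and "ok p (g [Z])"
    and "reaches_with (\<lambda>Ys. g (Z # Ys)) X T (p @ [g [Z]])"
proof -
  have *: "\<exists>n. g [Z] \<in> Z \<and> ok p (g [Z]) \<and>
      p @ [g [Z]] @ plays (\<lambda>Ys. g (Z # Ys)) Y n \<in> T \<and>
      (\<forall>i<n. g (Z # map Y [0..<Suc i]) \<in> Y i \<and>
        ok (p @ [g [Z]] @ plays (\<lambda>Ys. g (Z # Ys)) Y i) (g (Z # map Y [0..<Suc i])))"
    if Y: "\<forall>i. Y i \<in> P \<and> Y i \<subseteq> X" for Y :: "nat \<Rightarrow> 'a set"
  proof -
    let ?Y = "case_nat Z Y"
    have "\<forall>i. ?Y i \<in> P \<and> ?Y i \<subseteq> X" using Y Z by (auto split: nat.split)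
    then obtain n where n: "p @ plays g ?Y n \<in> T"
      and l: "\<And>i. i < n \<Longrightarrow> g (map ?Y [0..<Suc i]) \<in> ?Y i \<and>
        ok (p @ plays g ?Y i) (g (map ?Y [0..<Suc i]))"
      using g unfolding reaches_with_def by blast
    from n \<open>p \<notin> T\<close> obtain m where m: "n = Suc m" by (cases n) auto
    have s: "map ?Y [0..<Suc (Suc i)] = Z # map Y [0..<Suc i]" for i
      unfolding map_upt_Suc_shift[of ?Y "Suc i"] by simp
    show ?thesis
    proof (intro exI[of _ m] conjI allI impI)
      show "g [Z] \<in> Z" "ok p (g [Z])" using l[of 0] m by auto
      show "p @ [g [Z]] @ plays (\<lambda>Ys. g (Z # Ys)) Y m \<in> T"
        using n unfolding m plays_Suc by simp
      fix i assume "i < m"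
      then show "g (Z # map Y [0..<Suc i]) \<in> Y i"
        "ok (p @ [g [Z]] @ plays (\<lambda>Ys. g (Z # Ys)) Y i) (g (Z # map Y [0..<Suc i]))"
        using l[of "Suc i"] unfolding m s plays_Suc by simp_all
    qed
  qed
  show "g [Z] \<in> Z" "ok p (g [Z])" using *[of "\<lambda>_. Z"] Z by auto
  show "reaches_with (\<lambda>Ys. g (Z # Ys)) X T (p @ [g [Z]])"
    unfolding reaches_with_def using * by simp
qed

text \<open>A winning reply to each first subspace is glued to a strategy for the rest. The
  contrapositive serves \<open>open_dichotomy\<close>: it gives a subspace all of whose legal moves
  fail.\<close>

lemma II_reaches_step:
  assumes "\<And>Z. Z \<in> P \<Longrightarrow> Z \<subseteq> X \<Longrightarrow> \<exists>y\<in>Z. ok p y \<and> II_reaches X T (p @ [y])"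
  shows "II_reaches X T p"
proof -
  obtain h g' where h: "\<And>Z. Z \<in> P \<Longrightarrow> Z \<subseteq> X \<Longrightarrow>
      h Z \<in> Z \<and> ok p (h Z) \<and> reaches_with (g' Z) X T (p @ [h Z])"
    using assms unfolding II_reaches_def by metis
  define g where "g Ys = (if tl Ys = [] then h (hd Ys) else g' (hd Ys) (tl Ys))" for Ys
  have "reaches_with g X T p"
    unfolding reaches_with_def
  proof (intro allI impI)
    fix Y :: "nat \<Rightarrow> 'a set"
    assume Y: "\<forall>i. Y i \<in> P \<and> Y i \<subseteq> X"
    let ?Y = "\<lambda>i. Y (Suc i)"
    from Y h[of "Y 0"] have 0: "h (Y 0) \<in> Y 0" "ok p (h (Y 0))"
      "reaches_with (g' (Y 0)) X T (p @ [h (Y 0)])" by auto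
    from 0(3) Y obtain n where n: "(p @ [h (Y 0)]) @ plays (g' (Y 0)) ?Y n \<in> T"
      and l: "\<And>i. i < n \<Longrightarrow> g' (Y 0) (map ?Y [0..<Suc i]) \<in> ?Y i \<and>
        ok ((p @ [h (Y 0)]) @ plays (g' (Y 0)) ?Y i) (g' (Y 0) (map ?Y [0..<Suc i]))"
      unfolding reaches_with_def by meson
    have g1: "g [Y 0] = h (Y 0)" by (simp add: g_def)
    have g2: "g (map Y [0..<Suc (Suc i)]) = g' (Y 0) (map ?Y [0..<Suc i])" for i
      unfolding map_upt_Suc_shift[of Y "Suc i"] by (simp add: g_def)
    have g3: "plays g Y (Suc i) = h (Y 0) # plays (g' (Y 0)) ?Y i" for i
      unfolding plays_Suc g1 by (simp add: plays_def g_def)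
    show "\<exists>n. p @ plays g Y n \<in> T \<and>
       (\<forall>i<n. g (map Y [0..<Suc i]) \<in> Y i \<and> ok (p @ plays g Y i) (g (map Y [0..<Suc i])))"
    proof (intro exI[of _ "Suc n"] conjI allI impI)
      show "p @ plays g Y (Suc n) \<in> T" using n unfolding g3 by simp
    next
      fix i assume i: "i < Suc n"
      show "g (map Y [0..<Suc i]) \<in> Y i"
      proof (cases i)
        case (Suc j)
        with i have "j < n" by simp
        from l[OF this] show ?thesis unfolding Suc g2 by blast
      qed (use 0 g1 in simp)
      show "ok (p @ plays g Y i) (g (map Y [0..<Suc i]))"
      proof (cases i)
        case (Suc j)
        with i have "j < n" by simp
        from l[OF this] show ?thesis unfolding Suc g2 g3 by simp
      qed (use 0 g1 in simp)
    qed
  qed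
  then show ?thesis unfolding II_reaches_def by blast
qed

text \<open>Player II answers \<open>Y\<close> as if player I had played \<open>c Y\<close>, a
  subspace of both \<open>Y\<close> and \<open>X\<close>; the replies still lie in
  \<open>Y\<close>.\<close>

lemma hereditary_II_reaches: "hereditary (\<lambda>X. II_reaches X T p)"
  unfolding hereditary_def
proof (intro ballI impI)
  fix X X' assume X: "X \<in> P" "X' \<in> P" "almost_le X' X" "II_reaches X T p"
  then obtain g where g: "reaches_with g X T p" unfolding II_reaches_def by blast
  have "\<exists>Z\<in>P. Z \<subseteq> X \<and> Z \<subseteq> Y" if "Y \<in> P" "Y \<subseteq> X'" for Y
    using almost_le_refine[OF X(1) that(1)] almost_le_trans[OF almost_le_subset[OF that(2)] X(3)]
    by blast
  then obtain c where c: "\<And>Y. Y \<in> P \<Longrightarrow> Y \<subseteq> X' \<Longrightarrow> c Y \<in> P \<and> c Y \<subseteq> X \<and> c Y \<subseteq> Y" by metis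
  have "reaches_with (\<lambda>Ys. g (map c Ys)) X' T p"
    unfolding reaches_with_def
  proof (intro allI impI)
    fix Y :: "nat \<Rightarrow> 'a set"
    assume Y: "\<forall>i. Y i \<in> P \<and> Y i \<subseteq> X'"
    have "\<forall>i. (c \<circ> Y) i \<in> P \<and> (c \<circ> Y) i \<subseteq> X" using c Y by simp
    then obtain n where n: "p @ plays g (c \<circ> Y) n \<in> T" and
      l: "\<And>i. i < n \<Longrightarrow> g (map (c \<circ> Y) [0..<Suc i]) \<in> (c \<circ> Y) i \<and>
        ok (p @ plays g (c \<circ> Y) i) (g (map (c \<circ> Y) [0..<Suc i]))"
      using g unfolding reaches_with_def by blast
    have map: "map (c \<circ> Y) xs = map c (map Y xs)" for xs by simp
    have plays: "plays g (c \<circ> Y) i = plays (\<lambda>Ys. g (map c Ys)) Y i" for i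
      unfolding plays_def map ..
    have "(c \<circ> Y) i \<subseteq> Y i" for i using c Y by simp
    then have "g (map c (map Y [0..<Suc i])) \<in> Y i \<and>
        ok (p @ plays (\<lambda>Ys. g (map c Ys)) Y i) (g (map c (map Y [0..<Suc i])))"
      if "i < n" for i
      using l[OF that] unfolding map plays by (blast dest: subsetD)
    then show "\<exists>n. p @ plays (\<lambda>Ys. g (map c Ys)) Y n \<in> T \<and>
       (\<forall>i<n. g (map c (map Y [0..<Suc i])) \<in> Y i \<and>
         ok (p @ plays (\<lambda>Ys. g (map c Ys)) Y i) (g (map c (map Y [0..<Suc i]))))"
      using n unfolding plays by blast
  qed
  then show "II_reaches X' T p" unfolding II_reaches_def by blast
qed

text \<open>A first fusion makes the existence of a strategy independent of the subspace below
  \<open>Y\<close>. A second one provides, at each position without a strategy, an \<open>n\<close>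
  beyond which no single move leads to a position with one.\<close>

lemma open_dichotomy:
  fixes T :: "'i \<Rightarrow> 'a list set"
  assumes "countable (UNIV :: 'i set)" and "V \<in> P"
  shows "\<exists>W\<in>P. W \<subseteq> V \<and> (\<forall>k p. II_reaches W (T k) p \<or>
    (\<exists>n. \<forall>y \<in> W \<inter> U n. \<not> II_reaches W (T k) (p @ [y])))"
proof -
  have "countable (UNIV :: 'a list set)"
    using countable_lists[OF countable_points] by simp
  then have ct: "countable (UNIV :: ('i \<times> 'a list) set)"
    using countable_SIGMA[OF assms(1), of "\<lambda>_. UNIV :: 'a list set"] by simp
  obtain Y where Y: "Y \<in> P" "Y \<subseteq> V" and dec: "\<And>k p. II_reaches Y (T k) p \<or>
      (\<forall>Z\<in>P. Z \<subseteq> Y \<longrightarrow> \<not> II_reaches Z (T k) p)"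
    using decide_countably_many[OF ct \<open>V \<in> P\<close>, of "\<lambda>(k, p) X. II_reaches X (T k) p"]
      hereditary_II_reaches by (auto split: prod.split)
  \<comment> \<open>The second alternative speaks of the fixed \<open>Y\<close>, not of
    \<open>W\<close>, because lack of a strategy in \<open>W\<close> is not by itself hereditary;
    \<open>dec\<close> converts it at the end.\<close>
  define D where "D kp W \<longleftrightarrow> II_reaches W (T (fst kp)) (snd kp) \<or>
    (\<exists>n. \<forall>y \<in> W \<inter> U n. \<not> II_reaches Y (T (fst kp)) (snd kp @ [y]))"
    for kp :: "'i \<times> 'a list" and W
  have "\<exists>W\<in>P. W \<subseteq> Y \<and> (\<forall>kp. D kp W)"
  proof (rule fuse_countably_many[OF ct Y(1)])
    fix kp :: "'i \<times> 'a list"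
    show "hereditary (D kp)"
      unfolding hereditary_def
    proof (intro ballI impI)
      fix X X' assume X: "X \<in> P" "X' \<in> P" "almost_le X' X" and "D kp X"
      then consider "II_reaches X (T (fst kp)) (snd kp)"
        | n where "\<forall>y \<in> X \<inter> U n. \<not> II_reaches Y (T (fst kp)) (snd kp @ [y])"
        unfolding D_def by blast
      then show "D kp X'"
      proof cases
        case 1
        then show ?thesis unfolding D_def using hereditaryD[OF hereditary_II_reaches X] by blast
      next
        case 2
        obtain N where "X' \<inter> U N \<subseteq> X" using X(3) unfolding almost_le_def by blast
        then have "X' \<inter> U (max n N) \<subseteq> X \<inter> U n"
          using U_antimono[of n "max n N"] U_antimono[of N "max n N"] by fastforce
        then show ?thesis unfolding D_def using 2 by blast
      qed
    qed
  next
    fix kp :: "'i \<times> 'a list" and X assume X: "X \<in> P" "X \<subseteq> Y"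
    obtain k p where kp: "kp = (k, p)" by fastforce
    show "\<exists>Z\<in>P. Z \<subseteq> X \<and> D kp Z"
    proof (cases "II_reaches X (T k) p")
      case True
      then show ?thesis using X unfolding D_def kp by auto
    next
      case False
      then obtain Z where Z: "Z \<in> P" "Z \<subseteq> X"
        and no: "\<And>y. y \<in> Z \<Longrightarrow> ok p y \<Longrightarrow> \<not> II_reaches X (T k) (p @ [y])"
        using II_reaches_step by blast
      obtain N where "U N \<subseteq> {y. ok p y}" using eventually_ok by blast
      \<comment> \<open>Moves beyond \<open>N\<close> are all legal, and by heredity a strategy in
        \<open>Y\<close> would give one in \<open>X\<close>.\<close>
      then have "\<forall>y \<in> Z \<inter> U N. \<not> II_reaches Y (T k) (p @ [y])"
        using no hereditaryD[OF hereditary_II_reaches Y(1) X(1) almost_le_subset[OF X(2)]] by blast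
      then show ?thesis using Z unfolding D_def kp by auto
    qed
  qed
  then obtain W where W: "W \<in> P" "W \<subseteq> Y" "\<And>kp. D kp W" by blast
  have no: "\<not> II_reaches W (T k) p" if "\<not> II_reaches Y (T k) p" for k p
    using that dec[of k p] W(1,2) by blast
  have "II_reaches W (T k) p \<or> (\<exists>n. \<forall>y \<in> W \<inter> U n. \<not> II_reaches W (T k) (p @ [y]))"
    for k p
  proof -
    consider "II_reaches W (T k) p"
      | n where "\<forall>y \<in> W \<inter> U n. \<not> II_reaches Y (T k) (p @ [y])"
      using W(3)[of "(k, p)"] unfolding D_def by auto
    then show ?thesis
    proof cases
      case 2
      then have "\<forall>y \<in> W \<inter> U n. \<not> II_reaches W (T k) (p @ [y])" using no by simp
      then show ?thesis by (intro disjI2 exI)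
    qed simp
  qed
  then show ?thesis using W(1,2) Y(2) by (intro bexI[of _ W]) auto
qed

text \<open>Player I runs countably many strategies in parallel; as only finitely many numbers can be
  majorised in one round, the strategy against \<open>C n\<close> is taken up only after round \<open>n\<close>.\<close>

lemma I_avoids_Union:
  assumes "B \<subseteq> (\<Union>n. C n)" and "p \<in> S"
    and safe: "\<And>q. q \<in> S \<Longrightarrow> \<exists>m. \<forall>y \<in> W \<inter> U m. q @ [y] \<in> S"
    and avoid: "\<And>q n. q \<in> S \<Longrightarrow> length p < length q \<Longrightarrow> n < length q \<Longrightarrow> I_avoids W q (C n)"
  shows "I_avoids W p B"
proof -
  obtain m where m: "\<And>q y. q \<in> S \<Longrightarrow> y \<in> W \<inter> U (m q) \<Longrightarrow> q @ [y] \<in> S"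
    using safe by metis
  define wins where "wins \<tau> q n \<longleftrightarrow> (\<forall>x. map x [0..<length q] = q \<longrightarrow>
      (\<forall>i\<ge>length q. x i \<in> W \<inter> U (\<tau> (map x [0..<i]))) \<longrightarrow> x \<notin> C n)" for \<tau> q n
  define \<tau> where "\<tau> q n = (SOME \<tau>. wins \<tau> q n)" for q n
  have \<tau>: "wins (\<tau> q n) q n" if "q \<in> S" "length p < length q" "n < length q" for q n
    unfolding \<tau>_def using avoid[OF that] unfolding I_avoids_def wins_def[symmetric]
    by (rule someI_ex)
  \<comment> \<open>The first position length at which a strategy against \<open>C n\<close> is
    available: it must exceed both \<open>n\<close> and \<open>length p\<close>.\<close>
  define L where "L n = max (Suc n) (Suc (length p))" for n
  \<comment> \<open>\<open>\<sigma>\<close> majorises the bound that keeps the play in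
    \<open>S\<close> and the strategies chosen at the positions of length \<open>L n\<close>. Where
    \<open>q\<close> is shorter than \<open>L n\<close>, \<open>take\<close> returns
    \<open>q\<close> and the entry merely enlarges the number, which is harmless.\<close>
  define \<sigma> where "\<sigma> q = Max (insert (m q) ((\<lambda>n. \<tau> (take (L n) q) n q) ` {..<length q}))" for q
  show ?thesis
    unfolding I_avoids_def
  proof (intro exI[of _ \<sigma>] allI impI notI)
    fix x
    assume p: "map x [0..<length p] = p"
      and x: "\<forall>i\<ge>length p. x i \<in> W \<inter> U (\<sigma> (map x [0..<i]))" and "x \<in> B"
    then obtain n where "x \<in> C n" using assms(1) by blast
    have S: "map x [0..<i] \<in> S" if "length p \<le> i" for i
      using that
    proof (induction i rule: dec_induct)
      case base
      then show ?case using p \<open>p \<in> S\<close> by simp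
    next
      case (step i)
      have "m (map x [0..<i]) \<le> \<sigma> (map x [0..<i])" unfolding \<sigma>_def by (intro Max_ge) auto
      then have "x i \<in> W \<inter> U (m (map x [0..<i]))" using x step(1) U_antimono by blast
      then show ?case using m[OF step.IH] by simp
    qed
    have "map x [0..<L n] \<in> S" by (rule S) (simp add: L_def)
    then have L: "wins (\<tau> (map x [0..<L n]) n) (map x [0..<L n]) n"
      by (rule \<tau>) (simp_all add: L_def)
    have "x i \<in> W \<inter> U (\<tau> (map x [0..<L n]) n (map x [0..<i]))" if i: "L n \<le> i" for i
    proof -
      have "n < i" "length p \<le> i" using i unfolding L_def by auto
      have "\<tau> (take (L n) (map x [0..<i])) n (map x [0..<i]) \<le> \<sigma> (map x [0..<i])"
        unfolding \<sigma>_def using \<open>n < i\<close> by (intro Max_ge) auto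
      moreover have "take (L n) (map x [0..<i]) = map x [0..<L n]"
        using i by (simp add: take_map)
      ultimately have "U (\<sigma> (map x [0..<i])) \<subseteq> U (\<tau> (map x [0..<L n]) n (map x [0..<i]))"
        using U_antimono by simp
      then show ?thesis using x \<open>length p \<le> i\<close> by blast
    qed
    then have "x \<notin> C n" using L unfolding wins_def by simp
    then show False using \<open>x \<in> C n\<close> by blast
  qed
qed

end

section \<open>The game for a Souslin scheme\<close>

text \<open>In the application \<open>A s\<close> is the image of the cylinder of \<open>s\<close>,
  and \<open>closed\<close> expresses continuity at the branch \<open>\<alpha>\<close>.\<close>

locale souslin_game = gowers_space P U ok
  for P :: "'a set set" and U ok +
  fixes A :: "nat list \<Rightarrow> (nat \<Rightarrow> 'a) set"
  assumes branch: "\<And>s. A s \<subseteq> (\<Union>n. A (s @ [n]))"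
    and closed: "\<And>\<alpha> x. (\<And>k. \<exists>j\<ge>k. \<exists>y \<in> A (map \<alpha> [0..<j]). \<forall>i<k. y i = x i) \<Longrightarrow> x \<in> A []"
begin

definition bad :: "'a set \<Rightarrow> 'a list \<Rightarrow> nat list \<Rightarrow> bool" where
  "bad X p s \<longleftrightarrow> (\<forall>Y\<in>P. Y \<subseteq> X \<longrightarrow> \<not> I_avoids Y p (A s))"

text \<open>\<open>l < length q\<close> forces each phase to last at least one round;
  \<open>n < length q\<close> matches \<open>I_avoids_Union\<close>, where only strategies with
  index below the current length are in use.\<close>

definition target :: "'a set \<Rightarrow> nat list \<Rightarrow> nat \<Rightarrow> 'a list set" where
  "target X s l = {q. l < length q \<and> (\<exists>n<length q. bad X q (s @ [n]))}"

text \<open>If no member of \<open>A s\<close> extended \<open>p\<close>, player I would avoid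
  \<open>A s\<close> in \<open>X\<close> vacuously.\<close>

lemma bad_extension:
  assumes "X \<in> P" "bad X p s"
  shows "\<exists>y \<in> A s. map y [0..<length p] = p"
  using assms unfolding bad_def I_avoids_def by blast

lemma bad_imp_II_reaches:
  assumes X: "X \<in> P" and dec: "\<And>p s. I_avoids X p (A s) \<or> bad X p s"
    and W: "W \<in> P" "W \<subseteq> X"
    and dich: "\<And>s l p. II_reaches W (target X s l) p \<or>
      (\<exists>n. \<forall>y \<in> W \<inter> U n. \<not> II_reaches W (target X s l) (p @ [y]))"
    and "bad X p s"
  shows "II_reaches W (target X s (length p)) p"
proof (rule ccontr)
  let ?T = "target X s (length p)"
  assume no: "\<not> II_reaches W ?T p"
  have "I_avoids W p (A s)"
  proof (rule I_avoids_Union[OF branch])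
    show "p \<in> {q. \<not> II_reaches W ?T q}" using no by simp
    show "\<exists>m. \<forall>y \<in> W \<inter> U m. q @ [y] \<in> {q. \<not> II_reaches W ?T q}"
      if "q \<in> {q. \<not> II_reaches W ?T q}" for q
      using that dich by blast
    \<comment> \<open>\<open>q\<close> already has the lengths that \<open>target\<close> asks for,
      so lying outside it means not being bad for \<open>s @ [n]\<close>, and \<open>dec\<close>
      supplies a strategy.\<close>
    fix q n assume q: "q \<in> {q. \<not> II_reaches W ?T q}" "length p < length q" "n < length q"
    then have "q \<notin> ?T" using II_reaches_target by blast
    then have "I_avoids X q (A (s @ [n]))" using dec q unfolding target_def by blast
    then show "I_avoids W q (A (s @ [n]))"
      using hereditaryD[OF hereditary_I_avoids X W(1) almost_le_subset[OF W(2)]] by blast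
  qed
  then show False using \<open>bad X p s\<close> W unfolding bad_def by blast
qed

text \<open>A state of player II's composite strategy is a tuple \<open>(q, s, l, h)\<close>: the position \<open>q\<close>, the node \<open>s\<close>
  of the scheme reached so far, the length \<open>l\<close> of the position at which the current phase began, and
  the strategy \<open>h\<close>, for the rest of the phase, to reach a position that is bad for a child of \<open>s\<close>.\<close>

definition live :: "'a set \<Rightarrow> 'a set \<Rightarrow> 'a list \<times> nat list \<times> nat \<times> ('a set list \<Rightarrow> 'a) \<Rightarrow> bool" where
  "live X W = (\<lambda>(q, s, l, h). reaches_with h W (target X s l) q \<and> q \<notin> target X s l)"

text \<open>One round answering \<open>Z\<close>: the phase goes on with the residual strategy, or a
  child is reached. In the second case \<open>l'\<close> and \<open>h'\<close> are left to
  \<open>live\<close>.\<close>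

definition advances :: "'a set \<Rightarrow> 'a set \<Rightarrow> 'a list \<times> nat list \<times> nat \<times> ('a set list \<Rightarrow> 'a) \<Rightarrow>
    'a list \<times> nat list \<times> nat \<times> ('a set list \<Rightarrow> 'a) \<Rightarrow> bool" where
  "advances X Z = (\<lambda>(q, s, l, h) (q', s', l', h').
     q' = q @ [h [Z]] \<and> h [Z] \<in> Z \<and> ok q (h [Z]) \<and>
     ((s', l', h') = (s, l, \<lambda>Ys. h (Z # Ys)) \<or> (\<exists>n. s' = s @ [n]) \<and> bad X q' s'))"

text \<open>The strict inequality in \<open>target\<close> keeps \<open>p\<close> out of its own
  target, so a new phase starts live.\<close>

lemma live_start:
  assumes "bad X p s \<Longrightarrow> II_reaches W (target X s (length p)) p" and "bad X p s"
  shows "\<exists>h. live X W (p, s, length p, h)"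
  using assms unfolding live_def II_reaches_def target_def by auto

lemma live_advances:
  assumes step: "\<And>p s. bad X p s \<Longrightarrow> II_reaches W (target X s (length p)) p"
    and "live X W a" and Z: "Z \<in> P" "Z \<subseteq> W"
  shows "\<exists>b. live X W b \<and> advances X Z a b"
proof -
  obtain q s l h where a: "a = (q, s, l, h)" by (cases a)
  have h: "reaches_with h W (target X s l) q" "q \<notin> target X s l"
    using assms(2) unfolding live_def a by auto
  let ?q = "q @ [h [Z]]"
  note move = reaches_with_move[OF h Z]
  show ?thesis
  proof (cases "?q \<in> target X s l")
    case False
    then have "live X W (?q, s, l, \<lambda>Ys. h (Z # Ys))" using move(3) unfolding live_def by simp
    moreover have "advances X Z a (?q, s, l, \<lambda>Ys. h (Z # Ys))"
      using move(1,2) unfolding advances_def a by simp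
    ultimately show ?thesis by blast
  next
    case True
    then obtain n where n: "bad X ?q (s @ [n])" unfolding target_def by blast
    obtain h' where "live X W (?q, s @ [n], length ?q, h')" using live_start[OF step n] n by blast
    moreover have "advances X Z a (?q, s @ [n], length ?q, h')"
      using move(1,2) n unfolding advances_def a by simp
    ultimately show ?thesis by blast
  qed
qed

lemma run_in_target:
  assumes X: "X \<in> P" and Y: "\<And>i. Y i \<in> P \<and> Y i \<subseteq> W"
    and st: "\<And>i. st i = (q i, s i, l i, h i)"
    and live: "\<And>i. live X W (st i)" and adv: "\<And>i. advances X (Y i) (st i) (st (Suc i))"
  shows "\<exists>x. map x [0..<length (q 0)] = q 0 \<and> (\<forall>i. x (length (q 0) + i) = h i [Y i]) \<and>
    x \<in> A []"
proof -
  define x where "x = conc (q 0) (\<lambda>i. h i [Y i])"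
  have q_Suc: "q (Suc i) = q i @ [h i [Y i]]" for i
    using adv[of i] unfolding advances_def st by simp
  have len_q: "length (q i) = length (q 0) + i" for i by (induction i) (auto simp: q_Suc)
  have x0: "map x [0..<length (q 0)] = q 0"
    unfolding x_def by (intro nth_equalityI) (auto simp: conc_def)
  have xi: "x (length (q 0) + i) = h i [Y i]" for i unfolding x_def by (simp add: conc_def)
  have q: "map x [0..<length (q i)] = q i" for i
  proof (induction i)
    case (Suc i)
    then show ?case by (simp add: q_Suc len_q[of i] xi)
  qed (simp add: x0)
  have s_Suc: "\<exists>u. s (Suc i) = s i @ u" for i
    using adv[of i] unfolding advances_def st by auto
  have s_mono: "\<exists>u. s j = s i @ u" if "i \<le> j" for i j
    using that
  proof (induction j rule: dec_induct)
    case (step j)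
    then show ?case using s_Suc[of j] by auto
  qed simp
  define switch where "switch i \<longleftrightarrow> length (s i) < length (s (Suc i)) \<and> bad X (q (Suc i)) (s (Suc i))"
    for i
  \<comment> \<open>\<open>n\<close> counts the rounds left until the target is hit. Without a
    switch in round \<open>i\<close> the same phase goes on with \<open>n\<close> one smaller, and
    liveness excludes \<open>n = 0\<close>.\<close>
  have switch_later: "\<exists>j\<ge>i. switch j"
    if "q i @ plays (h i) (\<lambda>j. Y (i + j)) n \<in> target X (s i) (l i)" for i n
    using that
  proof (induction n arbitrary: i)
    case 0
    then show ?case using live[of i] unfolding live_def st by simp
  next
    case (Suc n)
    show ?case
    proof (cases "switch i")
      case False
      then have "s (Suc i) = s i" "l (Suc i) = l i" "h (Suc i) = (\<lambda>Ys. h i (Y i # Ys))"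
        using adv[of i] unfolding advances_def st switch_def by auto
      then have "q (Suc i) @ plays (h (Suc i)) (\<lambda>j. Y (Suc i + j)) n \<in>
          target X (s (Suc i)) (l (Suc i))"
        using Suc.prems unfolding plays_Suc q_Suc by simp
      from Suc.IH[OF this] show ?thesis by (meson Suc_leD)
    qed blast
  qed
  have switch: "\<exists>j\<ge>i. switch j" for i
  proof -
    have "reaches_with (h i) W (target X (s i) (l i)) (q i)"
      using live[of i] unfolding live_def st by simp
    then have "\<exists>n. q i @ plays (h i) (\<lambda>j. Y (i + j)) n \<in> target X (s i) (l i)"
      unfolding reaches_with_def by (elim allE[of _ "\<lambda>j. Y (i + j)"]) (use Y in auto)
    then show ?thesis using switch_later by blast
  qed
  \<comment> \<open>Each switch lengthens the node and no round shortens it, so round number and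
    node length become large at a common switch.\<close>
  have far: "\<exists>i\<ge>k. k < length (s (Suc i)) \<and> switch i" for k
  proof (induction k)
    case 0
    obtain i where "switch i" using switch by blast
    moreover then have "0 < length (s (Suc i))" unfolding switch_def by linarith
    ultimately show ?case by blast
  next
    case (Suc k)
    then obtain i where i: "i \<ge> k" "k < length (s (Suc i))" by blast
    obtain j where j: "j \<ge> Suc i" "switch j" using switch by blast
    have "length (s (Suc i)) \<le> length (s j)" using s_mono[OF j(1)] by auto
    then show ?case using i j unfolding switch_def by (intro exI[of _ j]) auto
  qed
  \<comment> \<open>By \<open>s_mono\<close> every node that is long enough has the same entry at
    \<open>k\<close>, and \<open>far\<close> provides such a node.\<close>
  define \<alpha> where "\<alpha> k = s (LEAST i. k < length (s i)) ! k" for k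
  have s: "map \<alpha> [0..<length (s i)] = s i" for i
  proof (intro nth_equalityI)
    fix k assume "k < length (map \<alpha> [0..<length (s i)])"
    then have k: "k < length (s i)" by simp
    let ?m = "LEAST i. k < length (s i)"
    have "?m \<le> i" "k < length (s ?m)"
      by (rule Least_le, rule k) (rule LeastI[of "\<lambda>i. k < length (s i)", OF k])
    moreover then obtain u where "s i = s ?m @ u" using s_mono by blast
    ultimately show "map \<alpha> [0..<length (s i)] ! k = s i ! k"
      unfolding \<alpha>_def using k by (simp add: nth_append)
  qed simp
  have "x \<in> A []"
  proof (rule closed)
    fix k
    obtain i where i: "i \<ge> k" "k < length (s (Suc i))" and "switch i" using far by blast
    then have "bad X (q (Suc i)) (s (Suc i))" unfolding switch_def by blast
    then obtain y where y: "y \<in> A (s (Suc i))" "map y [0..<length (q (Suc i))] = q (Suc i)"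
      using bad_extension[OF X] by blast
    have "\<forall>j<k. y j = x j"
    proof (intro allI impI)
      fix j assume "j < k"
      then have "j < length (q (Suc i))" using i unfolding len_q[of "Suc i"] by simp
      moreover have "map y [0..<length (q (Suc i))] ! j = map x [0..<length (q (Suc i))] ! j"
        unfolding y q ..
      ultimately show "y j = x j" by simp
    qed
    then show "\<exists>j\<ge>k. \<exists>y\<in>A (map \<alpha> [0..<j]). \<forall>i<k. y i = x i"
      using y(1) i(2) by (intro exI[of _ "length (s (Suc i))"]) (auto simp: s)
  qed
  then show ?thesis using x0 xi by blast
qed

lemma II_wins_if_bad:
  assumes X: "X \<in> P"
    and step: "\<And>p s. bad X p s \<Longrightarrow> II_reaches W (target X s (length p)) p"
    and "bad X z []"
  shows "\<exists>\<sigma>. \<forall>Y. (\<forall>i. Y i \<in> P \<and> Y i \<subseteq> W) \<longrightarrow>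
    (\<forall>i. \<sigma> (map Y [0..<Suc i]) \<in> Y i \<and> ok (z @ plays \<sigma> Y i) (\<sigma> (map Y [0..<Suc i]))) \<and>
    conc z (\<lambda>i. \<sigma> (map Y [0..<Suc i])) \<in> A []"
proof -
  obtain h0 where h0: "live X W (z, [], length z, h0)" using live_start[OF step] assms(3) by blast
  \<comment> \<open>A fixed choice function for the next state makes it depend only on what player
    II has seen.\<close>
  have "\<exists>N. \<forall>Z a. Z \<in> P \<and> Z \<subseteq> W \<and> live X W a \<longrightarrow> live X W (N a Z) \<and> advances X Z a (N a Z)"
    using live_advances[OF step] by metis
  then obtain N where N: "\<And>Z a. Z \<in> P \<Longrightarrow> Z \<subseteq> W \<Longrightarrow> live X W a \<Longrightarrow>
      live X W (N a Z) \<and> advances X Z a (N a Z)" by blast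
  define run where "run = foldl N (z, [], length z, h0)"
  \<comment> \<open>\<open>butlast\<close> gives the state before the current round. Its
    \<open>h\<close> has absorbed the earlier subspaces of the phase, hence the one-element
    list.\<close>
  define \<sigma> where "\<sigma> Zs = snd (snd (snd (run (butlast Zs)))) [last Zs]" for Zs
  show ?thesis
  proof (intro exI[of _ \<sigma>] allI impI)
    fix Y :: "nat \<Rightarrow> 'a set"
    assume Y: "\<forall>i. Y i \<in> P \<and> Y i \<subseteq> W"
    define st where "st i = run (map Y [0..<i])" for i
    define q s l h where "q i = fst (st i)" and "s i = fst (snd (st i))"
      and "l i = fst (snd (snd (st i)))" and "h i = snd (snd (snd (st i)))" for i
    have st: "st i = (q i, s i, l i, h i)" for i by (simp add: q_def s_def l_def h_def)
    have st0: "st 0 = (z, [], length z, h0)" by (simp add: st_def run_def)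
    have st_Suc: "st (Suc i) = N (st i) (Y i)" for i by (simp add: st_def run_def)
    have live: "live X W (st i)" for i
      by (induction i) (use h0 N Y in \<open>auto simp: st0 st_Suc\<close>)
    have adv: "advances X (Y i) (st i) (st (Suc i))" for i
      using N Y live unfolding st_Suc by blast
    have \<sigma>: "\<sigma> (map Y [0..<Suc i]) = h i [Y i]" for i by (simp add: \<sigma>_def h_def st_def)
    have q0: "q 0 = z" by (simp add: q_def st0)
    have move: "q (Suc i) = q i @ [h i [Y i]]" "h i [Y i] \<in> Y i" "ok (q i) (h i [Y i])" for i
      using adv[of i] unfolding advances_def st by simp_all
    have q: "z @ plays \<sigma> Y i = q i" for i
      by (induction i) (simp_all add: q0 move(1) plays_def \<sigma> del: upt_Suc, simp add: \<sigma>[simplified])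
    obtain x where x: "map x [0..<length z] = z" "\<And>i. x (length z + i) = h i [Y i]" "x \<in> A []"
      using run_in_target[of X Y W st q s l h, OF X _ st live adv] Y unfolding q0 by blast
    have "x = conc z (\<lambda>i. \<sigma> (map Y [0..<Suc i]))"
    proof
      fix j
      show "x j = conc z (\<lambda>i. \<sigma> (map Y [0..<Suc i])) j"
      proof (cases "j < length z")
        case True
        have "map x [0..<length z] ! j = z ! j" unfolding x(1) ..
        then show ?thesis using True by (simp add: conc_def)
      next
        case False
        then show ?thesis using x(2)[of "j - length z"] unfolding \<sigma> by (simp add: conc_def)
      qed
    qed
    with x(3) have "conc z (\<lambda>i. \<sigma> (map Y [0..<Suc i])) \<in> A []" by simp
    then show "(\<forall>i. \<sigma> (map Y [0..<Suc i]) \<in> Y i \<and> ok (z @ plays \<sigma> Y i) (\<sigma> (map Y [0..<Suc i]))) \<and>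
      conc z (\<lambda>i. \<sigma> (map Y [0..<Suc i])) \<in> A []"
      using move(2,3) unfolding q \<sigma> by blast
  qed
qed

lemma souslin_dichotomy:
  assumes "V \<in> P"
  shows "\<exists>W\<in>P. W \<subseteq> V \<and> (I_avoids W z (A []) \<or> (\<exists>\<sigma>. \<forall>Y. (\<forall>i. Y i \<in> P \<and> Y i \<subseteq> W) \<longrightarrow>
    (\<forall>i. \<sigma> (map Y [0..<Suc i]) \<in> Y i \<and> ok (z @ plays \<sigma> Y i) (\<sigma> (map Y [0..<Suc i]))) \<and>
    conc z (\<lambda>i. \<sigma> (map Y [0..<Suc i])) \<in> A []))"
proof -
  have "countable (UNIV :: 'a list set)"
    using countable_lists[OF countable_points] by simp
  then have ct: "countable (UNIV :: ('a list \<times> nat list) set)"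
    using countable_SIGMA[of UNIV "\<lambda>_. UNIV :: nat list set"] by simp
  have "\<exists>X\<in>P. X \<subseteq> V \<and> (\<forall>k. I_avoids X (fst k) (A (snd k)) \<or>
      (\<forall>Z\<in>P. Z \<subseteq> X \<longrightarrow> \<not> I_avoids Z (fst k) (A (snd k))))"
    using ct \<open>V \<in> P\<close> hereditary_I_avoids by (rule decide_countably_many)
  then obtain X where X: "X \<in> P" "X \<subseteq> V" and dec: "\<And>p s. I_avoids X p (A s) \<or> bad X p s"
    unfolding bad_def by (metis fst_conv snd_conv)
  \<comment> \<open>One subspace handles the targets for all nodes and all starting lengths.\<close>
  obtain W where W: "W \<in> P" "W \<subseteq> X" and dich: "\<And>k p. II_reaches W (target X (fst k) (snd k)) p \<or>
      (\<exists>n. \<forall>y \<in> W \<inter> U n. \<not> II_reaches W (target X (fst k) (snd k)) (p @ [y]))"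
    using open_dichotomy[where T = "\<lambda>k :: nat list \<times> nat. target X (fst k) (snd k)", OF _ X(1)]
    by auto
  have step: "II_reaches W (target X s (length p)) p" if "bad X p s" for p s
    using bad_imp_II_reaches[OF X(1) dec W _ that] dich[of "(s, l)" for s l] by simp
  show ?thesis
  proof (cases "I_avoids X z (A [])")
    case True
    then show ?thesis using X by blast
  next
    case False
    then have "bad X z []" using dec by blast
    from II_wins_if_bad[OF X(1) step this] show ?thesis using W X by blast
  qed
qed

end

section \<open>Block subspaces\<close>

context vector_space_with_basis
begin

lemma supp_empty_iff: "supp x = {} \<longleftrightarrow> x = 0"
proof
  assume "supp x = {}"
  then have "{b. representation (range e) x b \<noteq> 0} = {}"
    using representation_ne_zero[of "range e" x] unfolding supp_def by auto
  then have "(\<Sum>b | representation (range e) x b \<noteq> 0. scale (representation (range e) x b) b) = 0"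
    by simp
  then show "x = 0"
    using sum_nonzero_representation_eq[OF independent_basis] span_basis by simp
qed (simp add: supp_def representation_zero)

lemma finite_supp: "finite (supp x)"
proof -
  have "finite (e -` {b. representation (range e) x b \<noteq> 0})"
    by (intro finite_vimageI finite_representation inj_basis)
  then show ?thesis by (simp add: supp_def vimage_def)
qed

lemma subspace_supp_subset: "subspace {x. supp x \<subseteq> K}"
  unfolding subspace_def supp_def
  by (auto simp: representation_zero representation_add representation_scale
      independent_basis span_basis, force)

lemma span_supp_subset: "(\<And>x. x \<in> S \<Longrightarrow> supp x \<subseteq> K) \<Longrightarrow> x \<in> span S \<Longrightarrow> supp x \<subseteq> K"
  using span_minimal[OF _ subspace_supp_subset] by blast

lemma nat_less_vec_iff: "nat_less_vec k x \<longleftrightarrow> supp x \<subseteq> {k<..}"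
  unfolding nat_less_vec_def by auto

lemma vec_less_eventually: "\<exists>N. \<forall>y. nat_less_vec N y \<longrightarrow> vec_less x y"
proof (intro exI allI impI)
  \<comment> \<open>For \<open>x = 0\<close> the value of \<open>Max (supp x)\<close> is arbitrary,
    but then \<open>vec_less\<close> holds vacuously.\<close>
  fix y assume y: "nat_less_vec (Max (supp x)) y"
  have "n \<le> Max (supp x)" if "n \<in> supp x" for n using that finite_supp by simp
  then show "vec_less x y" using y unfolding nat_less_vec_def vec_less_def by (meson le_less_trans)
qed

text \<open>Each vector is a finite combination of basis vectors, hence coded by a list of
  coefficient-index pairs.\<close>

lemma countable_vectors:
  assumes "countable (UNIV :: 'f set)"
  shows "countable (UNIV :: 'e set)"
proof -
  have "countable (UNIV :: ('f \<times> nat) set)"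
    using countable_SIGMA[OF assms, of "\<lambda>_. UNIV :: nat set"] by simp
  then have ct: "countable (UNIV :: ('f \<times> nat) list set)" using countable_lists by fastforce
  define g where "g l = sum_list (map (\<lambda>(c, n). scale c (e n)) l)" for l :: "('f \<times> nat) list"
  have "\<exists>l. v = g l" for v
  proof -
    have "v \<in> span (range e)" using span_basis by simp
    then show ?thesis
    proof (induction rule: span_induct_alt)
      case base
      show ?case by (rule exI[of _ "[]"]) (simp add: g_def)
    next
      case (step c x y)
      then obtain n l where "x = e n" "y = g l" by blast
      then show ?case by (intro exI[of _ "(c, n) # l"]) (simp add: g_def)
    qed
  qed
  then have "UNIV = range g" by blast
  then show ?thesis using countable_image[OF ct, of g] by simp
qed

lemma vec_less_trans:
  assumes "y \<noteq> 0" "vec_less x y" "vec_less y z"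
  shows "vec_less x z"
  using assms supp_empty_iff[of y] unfolding vec_less_def by (metis all_not_in_conv less_trans)

lemma block_seq_less:
  assumes "block_seq x" "i < j"
  shows "vec_less (x i) (x j)"
  using assms(2)
proof (induction rule: less_Suc_induct)
  case (1 i)
  then show ?case using assms(1) unfolding block_seq_def by blast
next
  case (2 i j k)
  then show ?case using assms(1) vec_less_trans unfolding block_seq_def by blast
qed

text \<open>Each support is non-empty and lies strictly to the right of the preceding one, so its
  minimum grows by at least one per step.\<close>

lemma block_seq_supp_ge:
  assumes "block_seq x"
  shows "supp (x i) \<subseteq> {i..}"
proof (induction i)
  case (Suc i)
  obtain m where "m \<in> supp (x i)" using assms supp_empty_iff unfolding block_seq_def by blast
  then show ?case using Suc assms unfolding block_seq_def vec_less_def by fastforce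
qed simp

lemma block_seq_nat_less_vec: "block_seq x \<Longrightarrow> N < i \<Longrightarrow> nat_less_vec N (x i)"
  using block_seq_supp_ge[of x i] unfolding nat_less_vec_def by fastforce

lemma block_subspace_beyond:
  assumes "block_subspace X"
  shows "\<exists>x\<in>X. x \<noteq> 0 \<and> nat_less_vec N x"
proof -
  obtain x where x: "block_seq x" "X = span (range x)"
    using assms unfolding block_subspace_def by blast
  show ?thesis
  proof (intro bexI[of _ "x (Suc N)"] conjI)
    show "x (Suc N) \<noteq> 0" using x unfolding block_seq_def by blast
    show "nat_less_vec N (x (Suc N))" using x block_seq_nat_less_vec by simp
    show "x (Suc N) \<in> X" using x by (simp add: span_base)
  qed
qed

section \<open>Refinement and fusion of block subspaces\<close>

lemma subspace_block_subspace: "block_subspace X \<Longrightarrow> subspace X"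
  unfolding block_subspace_def by auto

text \<open>Dropping the first \<open>N + 1\<close> vectors of a block sequence for \<open>Y\<close>
  leaves a span whose non-zero vectors all lie beyond \<open>N\<close>, hence in
  \<open>X\<close>.\<close>

lemma block_subspace_refine:
  assumes X: "block_subspace X" and Y: "block_subspace Y"
    and XY: "\<And>y. y \<in> Y \<Longrightarrow> y \<noteq> 0 \<Longrightarrow> nat_less_vec N y \<Longrightarrow> y \<in> X"
  shows "\<exists>Z. block_subspace Z \<and> Z \<subseteq> X \<inter> Y"
proof -
  obtain y where y: "block_seq y" "Y = span (range y)" using Y unfolding block_subspace_def by blast
  let ?z = "\<lambda>i. y (i + Suc N)"
  have "block_seq ?z" using y unfolding block_seq_def by simp
  have "span (range ?z) \<subseteq> Y" unfolding y by (rule span_mono) auto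
  moreover have "z \<in> X" if z: "z \<in> span (range ?z)" for z
  proof (cases "z = 0")
    case True
    then show ?thesis using subspace_0[OF subspace_block_subspace[OF X]] by simp
  next
    case False
    have "supp (?z i) \<subseteq> {N<..}" for i
      using block_seq_nat_less_vec[OF y(1), of N "i + Suc N"] unfolding nat_less_vec_iff by simp
    then have "supp z \<subseteq> {N<..}" by (intro span_supp_subset[OF _ z]) blast
    then show ?thesis using XY z False calculation unfolding nat_less_vec_iff by blast
  qed
  ultimately show ?thesis using \<open>block_seq ?z\<close> unfolding block_subspace_def by blast
qed

text \<open>The diagonal sequence takes its \<open>n\<close>-th vector from \<open>X n\<close>. A
  vector of its span supported beyond the vector preceding index \<open>n\<close> has no component
  on the earlier ones, so it lies in \<open>X n\<close>.\<close>

lemma block_subspace_fuse: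
  fixes X :: "nat \<Rightarrow> 'e set"
  assumes X: "\<And>n. block_subspace (X n)" and dec: "\<And>n. X (Suc n) \<subseteq> X n"
  shows "\<exists>Y. block_subspace Y \<and> Y \<subseteq> X 0 \<and>
    (\<forall>n. \<exists>N. \<forall>y\<in>Y. y \<noteq> 0 \<longrightarrow> nat_less_vec N y \<longrightarrow> y \<in> X n)"
proof -
  have "\<exists>y. \<forall>n. (y n \<in> X n \<and> y n \<noteq> 0) \<and> vec_less (y n) (y (Suc n))"
  proof (rule dependent_nat_choice)
    show "\<exists>x. x \<in> X 0 \<and> x \<noteq> 0" using block_subspace_beyond[OF X[of 0]] by blast
    fix x n
    obtain N where N: "\<And>y. nat_less_vec N y \<Longrightarrow> vec_less x y"
      using vec_less_eventually by blast
    obtain y where "y \<in> X (Suc n)" "y \<noteq> 0" "nat_less_vec N y"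
      using block_subspace_beyond[OF X[of "Suc n"], of N] by blast
    with N show "\<exists>y. (y \<in> X (Suc n) \<and> y \<noteq> 0) \<and> vec_less x y" by blast
  qed
  then obtain y where y: "\<And>n. y n \<in> X n" "\<And>n. y n \<noteq> 0" "\<And>n. vec_less (y n) (y (Suc n))" by blast
  then have blk: "block_seq y" unfolding block_seq_def by blast
  have y_mem: "y i \<in> X n" if "n \<le> i" for i n
    using lift_Suc_antimono_le[of X, OF dec that] y(1) by blast
  have tail: "span (y ` {n..}) \<subseteq> X n" for n
    by (rule span_minimal[OF _ subspace_block_subspace[OF X]]) (auto simp: y_mem)
  have "\<exists>N. \<forall>v\<in>span (range y). v \<noteq> 0 \<longrightarrow> nat_less_vec N v \<longrightarrow> v \<in> X n" for n
  proof (cases n)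
    case 0
    then show ?thesis using tail[of 0] by (auto simp: atLeast_0)
  next
    case (Suc m)
    let ?N = "Max (supp (y m))"
    have N: "?N \<in> supp (y m)" by (rule Max_in) (use finite_supp supp_empty_iff y(2) in auto)
    have head: "supp a \<subseteq> {..?N}" if "a \<in> span (y ` {..m})" for a
    proof (rule span_supp_subset[OF _ that])
      fix x assume "x \<in> y ` {..m}"
      then obtain i where i: "i \<le> m" "x = y i" by blast
      show "supp x \<subseteq> {..?N}"
      proof (cases "i = m")
        case True
        then show ?thesis using i finite_supp by auto
      next
        case False
        then have "vec_less x (y m)" using block_seq_less[OF blk] i by simp
        then show ?thesis using N unfolding vec_less_def by (auto intro: less_imp_le)
      qed
    qed
    have late: "supp b \<subseteq> {?N<..}" if "b \<in> span (y ` {n..})" for b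
    proof (rule span_supp_subset[OF _ that])
      fix x assume "x \<in> y ` {n..}"
      then have "vec_less (y m) x" using block_seq_less[OF blk] Suc by auto
      then show "supp x \<subseteq> {?N<..}" using N unfolding vec_less_def by auto
    qed
    have "v \<in> X n" if v: "v \<in> span (range y)" "nat_less_vec ?N v" for v
    proof -
      have "range y = y ` {..m} \<union> y ` {n..}" using Suc by force
      then have "v \<in> span (y ` {..m} \<union> y ` {n..})" using v(1) by simp
      then obtain a b where ab: "v = a + b" "a \<in> span (y ` {..m})" "b \<in> span (y ` {n..})"
        unfolding span_Un by blast
      \<comment> \<open>The head \<open>a\<close> is supported both beyond \<open>?N\<close> and up
        to \<open>?N\<close>, so it vanishes.\<close>
      have "v - b \<in> {x. supp x \<subseteq> {?N<..}}"
        using v(2) late[OF ab(3)] subspace_diff[OF subspace_supp_subset]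
        unfolding nat_less_vec_iff by blast
      then have "supp a \<subseteq> {?N<..}" using ab(1) by simp
      then have "supp a = {}" using head[OF ab(2)] by fastforce
      then show ?thesis using ab tail unfolding supp_empty_iff by auto
    qed
    then show ?thesis by blast
  qed
  moreover have "span (range y) \<subseteq> X 0" using tail[of 0] by (simp add: atLeast_0)
  ultimately show ?thesis using blk unfolding block_subspace_def by blast
qed

section \<open>Block subspaces as an instance of the abstract space of moves\<close>

definition beyond :: "nat \<Rightarrow> 'e set" where
  "beyond N = {y. y \<noteq> 0 \<and> nat_less_vec N y}"

text \<open>Here \<open>q\<close> includes the initial sequence, so player II is made to play beyond it; the rules of
  the game do not ask for this, and it only makes winning harder.\<close>

definition legal :: "'e list \<Rightarrow> 'e \<Rightarrow> bool" where
  "legal q y \<longleftrightarrow> y \<noteq> 0 \<and> (q \<noteq> [] \<longrightarrow> vec_less (last q) y)"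

lemma gowers_space_block_subspaces:
  assumes "countable (UNIV :: 'f set)"
  shows "gowers_space {X. block_subspace X} beyond legal"
proof
  show "countable (UNIV :: 'e set)" by (rule countable_vectors[OF assms])
  show "beyond n \<subseteq> beyond m" if "m \<le> n" for m n
    using that unfolding beyond_def nat_less_vec_def by fastforce
  show "\<exists>Z\<in>{X. block_subspace X}. Z \<subseteq> X \<inter> Y"
    if "X \<in> {X. block_subspace X}" "Y \<in> {X. block_subspace X}" "Y \<inter> beyond N \<subseteq> X" for X Y N
    using block_subspace_refine[of X Y N] that unfolding beyond_def by blast
  show "\<exists>Y\<in>{X. block_subspace X}. Y \<subseteq> X 0 \<and> (\<forall>n. \<exists>N. Y \<inter> beyond N \<subseteq> X n)"
    if X: "\<And>n. X n \<in> {X. block_subspace X}" "\<And>n. X (Suc n) \<subseteq> X n" for X :: "nat \<Rightarrow> 'e set"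
  proof -
    obtain Y where "block_subspace Y" "Y \<subseteq> X 0"
      and "\<And>n. \<exists>N. \<forall>y\<in>Y. y \<noteq> 0 \<longrightarrow> nat_less_vec N y \<longrightarrow> y \<in> X n"
      using block_subspace_fuse[of X] X by auto
    moreover then have "\<exists>N. Y \<inter> beyond N \<subseteq> X n" for n unfolding beyond_def by blast
    ultimately show ?thesis by blast
  qed
  show "\<exists>N. beyond N \<subseteq> {y. legal q y}" for q
    using vec_less_eventually[of "last q"] unfolding beyond_def legal_def by blast
qed

end

section \<open>Analytic sets\<close>

text \<open>Continuity into a discrete factor is local constancy: the open set around
  \<open>\<beta>\<close> contains a box that restricts finitely many coordinates only, and
  \<open>m\<close> bounds them.\<close>

lemma discrete_sequence_continuity:
  assumes "continuous_map discrete_sequence_space discrete_sequence_space f"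
  shows "\<exists>m. \<forall>\<gamma>. (\<forall>i<m. \<gamma> i = \<beta> i) \<longrightarrow> f \<gamma> k = f \<beta> k"
proof -
  let ?O = "{\<gamma>. f \<gamma> k = f \<beta> k}"
  have "continuous_map discrete_sequence_space (discrete_topology UNIV) (\<lambda>\<gamma>. f \<gamma> k)"
    using assms unfolding discrete_sequence_space_def continuous_map_componentwise_UNIV by blast
  then have "openin discrete_sequence_space {\<gamma> \<in> topspace discrete_sequence_space. f \<gamma> k \<in> {f \<beta> k}}"
    by (rule openin_continuous_map_preimage) simp
  then have "openin discrete_sequence_space ?O"
    by (simp add: discrete_sequence_space_def)
  then obtain B where B: "\<beta> \<in> (\<Pi>\<^sub>E i\<in>UNIV. B i)" "finite {i. B i \<noteq> UNIV}" "(\<Pi>\<^sub>E i\<in>UNIV. B i) \<subseteq> ?O"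
    unfolding discrete_sequence_space_def
    using product_topology_open_contains_basis[of "\<lambda>_. discrete_topology UNIV" UNIV ?O \<beta>] by auto
  obtain m where m: "\<And>i. B i \<noteq> UNIV \<Longrightarrow> i < m"
    using B(2) finite_nat_set_iff_bounded by auto
  have "f \<gamma> k = f \<beta> k" if "\<forall>i<m. \<gamma> i = \<beta> i" for \<gamma>
  proof -
    have "\<gamma> i \<in> B i" for i
      using that B(1) m[of i] by (cases "i < m") (auto simp: PiE_iff)
    then show ?thesis using B(3) by (auto simp: PiE_iff)
  qed
  then show ?thesis by blast
qed

text \<open>The scheme consists of the images of cylinders. If its members along
  \<open>\<alpha>\<close> approximate \<open>x\<close>, continuity at \<open>\<alpha>\<close> forces
  \<open>x = f \<alpha>\<close>.\<close>

lemma analytic_souslin_scheme: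
  assumes "analytic_set_in discrete_sequence_space A"
  obtains S :: "nat list \<Rightarrow> (nat \<Rightarrow> 'a) set" where "S [] = A"
    and "\<forall>s. S s \<subseteq> (\<Union>n. S (s @ [n]))"
    and "\<forall>\<alpha> x. (\<forall>k. \<exists>j\<ge>k. \<exists>y \<in> S (map \<alpha> [0..<j]). \<forall>i<k. y i = x i) \<longrightarrow> x \<in> S []"
proof (cases "A = {}")
  case True
  then show ?thesis by (intro that[of "\<lambda>_. {}"]) auto
next
  case False
  then obtain f :: "(nat \<Rightarrow> nat) \<Rightarrow> nat \<Rightarrow> 'a"
    where f: "continuous_map discrete_sequence_space discrete_sequence_space f"
    and A: "range f = A"
    using assms unfolding analytic_set_in_def by (auto simp: discrete_sequence_space_def)
  define S where "S s = f ` {\<beta>. map \<beta> [0..<length s] = s}" for s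
  show ?thesis
  proof (rule that)
    show "S [] = A" using A by (simp add: S_def)
    show "\<forall>s. S s \<subseteq> (\<Union>n. S (s @ [n]))" by (auto simp: S_def)
    show "\<forall>\<alpha> x. (\<forall>k. \<exists>j\<ge>k. \<exists>y \<in> S (map \<alpha> [0..<j]). \<forall>i<k. y i = x i) \<longrightarrow> x \<in> S []"
    proof (intro allI impI)
      fix \<alpha> x assume near: "\<forall>k. \<exists>j\<ge>k. \<exists>y \<in> S (map \<alpha> [0..<j]). \<forall>i<k. y i = x i"
      have "f \<alpha> i = x i" for i
      proof -
        obtain m where m: "\<And>\<gamma>. \<forall>i<m. \<gamma> i = \<alpha> i \<Longrightarrow> f \<gamma> i = f \<alpha> i"
          using discrete_sequence_continuity[OF f] by blast
        \<comment> \<open>The argument of \<open>y\<close> must agree with \<open>\<alpha>\<close>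
          below \<open>m\<close>, and \<open>y\<close> with \<open>x\<close> at \<open>i\<close>
          itself; hence \<open>max m (Suc i)\<close>.\<close>
        obtain j y where j: "j \<ge> max m (Suc i)" and y: "y \<in> S (map \<alpha> [0..<j])"
          and "\<forall>l<max m (Suc i). y l = x l"
          using near by blast
        then have "y i = x i" by simp
        obtain \<gamma> where "y = f \<gamma>" and \<gamma>: "map \<gamma> [0..<j] = map \<alpha> [0..<j]"
          using y by (auto simp: S_def)
        have "\<gamma> l = \<alpha> l" if "l < m" for l
          using arg_cong[OF \<gamma>, of "\<lambda>xs. xs ! l"] that j by simp
        then have "f \<gamma> i = f \<alpha> i" using m by blast
        then show ?thesis using \<open>y = f \<gamma>\<close> \<open>y i = x i\<close> by simp
      qed
      then have "x = f \<alpha>" by auto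
      then show "x \<in> S []" by (simp add: S_def)
    qed
  qed
qed

section \<open>Translation back to the two games on block subspaces\<close>

context vector_space_with_basis
begin

lemma I_has_strategy_asymptotic_if_avoids:
  assumes space: "gowers_space P beyond legal" and avoids: "gowers_space.I_avoids beyond W z A"
  shows "I_has_strategy_asymptotic W z (UNIV - A)"
proof -
  obtain \<sigma> where \<sigma>: "\<And>x. map x [0..<length z] = z \<Longrightarrow>
     (\<And>i. length z \<le> i \<Longrightarrow> x i \<in> W \<inter> beyond (\<sigma> (map x [0..<i]))) \<Longrightarrow> x \<notin> A"
    using avoids unfolding gowers_space.I_avoids_def[OF space] by blast
  \<comment> \<open>The rules want increasing numbers: the maximum over all prefixes is
    non-decreasing, the added length makes it strict, and the result still majorises
    \<open>\<sigma>\<close>.\<close>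
  define \<tau> where "\<tau> xs = length xs + Max ((\<lambda>i. \<sigma> (z @ take i xs)) ` {..length xs})" for xs
  show ?thesis
    unfolding I_has_strategy_asymptotic_def Let_def
  proof (intro exI[of _ \<tau>] allI impI conjI)
    fix x :: "nat \<Rightarrow> 'e" and i
    have take: "take j (map x [0..<i]) = map x [0..<j]" if "j \<le> i" for i j
      using that by (simp add: take_map)
    have \<tau>: "\<tau> (map x [0..<i]) = i + Max ((\<lambda>j. \<sigma> (z @ map x [0..<j])) ` {..i})" for i
      unfolding \<tau>_def using take by (auto intro!: arg_cong[of _ _ Max] image_cong)
    show "\<tau> (map x [0..<i]) < \<tau> (map x [0..<Suc i])"
      unfolding \<tau> by (intro add_less_le_mono Max_mono) auto
    assume x: "\<forall>i. x i \<noteq> 0 \<and> x i \<in> W \<and> nat_less_vec (\<tau> (map x [0..<i])) (x i) \<and>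
      vec_less (x i) (x (Suc i))"
    have "conc z x \<notin> A"
    proof (rule \<sigma>)
      show "map (conc z x) [0..<length z] = z"
        by (intro nth_equalityI) (auto simp: conc_def)
      fix i assume i: "length z \<le> i"
      define j where "j = i - length z"
      have "map (conc z x) [0..<i] = z @ map x [0..<j]"
        using i by (intro nth_equalityI) (auto simp: conc_def nth_append j_def)
      moreover have "\<sigma> (z @ map x [0..<j]) \<le> \<tau> (map x [0..<j])"
        unfolding \<tau> by (intro trans_le_add2 Max_ge) auto
      moreover have "conc z x i = x j" using i by (simp add: conc_def j_def)
      ultimately show "conc z x i \<in> W \<inter> beyond (\<sigma> (map (conc z x) [0..<i]))"
        using x[rule_format, of j] unfolding beyond_def nat_less_vec_def by fastforce
    qed
    then show "conc z x \<in> UNIV - A" by simp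
  qed
qed

lemma analytic_strategically_Ramsey:
  assumes "countable (UNIV :: 'f set)" and "analytic_set_in discrete_sequence_space A"
  shows "strategically_Ramsey A"
  unfolding strategically_Ramsey_def
proof (intro allI impI)
  fix V z assume V: "block_subspace V \<and> finite_block_seq z"
  obtain S :: "nat list \<Rightarrow> (nat \<Rightarrow> 'e) set" where S: "S [] = A"
    "\<forall>s. S s \<subseteq> (\<Union>n. S (s @ [n]))"
    "\<forall>\<alpha> x. (\<forall>k. \<exists>j\<ge>k. \<exists>y \<in> S (map \<alpha> [0..<j]). \<forall>i<k. y i = x i) \<longrightarrow> x \<in> S []"
    using analytic_souslin_scheme[OF assms(2)] .
  note space = gowers_space_block_subspaces[OF assms(1)]
  interpret souslin_game "{X. block_subspace X}" beyond legal S
  proof (intro souslin_game.intro souslin_game_axioms.intro space)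
    show "S s \<subseteq> (\<Union>n. S (s @ [n]))" for s using S(2) ..
    show "x \<in> S []"
      if "\<And>k. \<exists>j\<ge>k. \<exists>y \<in> S (map \<alpha> [0..<j]). \<forall>i<k. y i = x i" for \<alpha> x
      by (rule S(3)[rule_format, OF that])
  qed
  obtain W where W: "block_subspace W" "W \<subseteq> V"
    and "I_avoids W z A \<or> (\<exists>\<sigma>. \<forall>Y. (\<forall>i. block_subspace (Y i) \<and> Y i \<subseteq> W) \<longrightarrow>
      (\<forall>i. \<sigma> (map Y [0..<Suc i]) \<in> Y i \<and> legal (z @ plays \<sigma> Y i) (\<sigma> (map Y [0..<Suc i]))) \<and>
      conc z (\<lambda>i. \<sigma> (map Y [0..<Suc i])) \<in> A)"
    using souslin_dichotomy[of V z] V unfolding S(1) mem_Collect_eq bex_simps by blast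
  then consider "I_avoids W z A" | \<sigma> where "\<And>Y. \<forall>i. block_subspace (Y i) \<and> Y i \<subseteq> W \<Longrightarrow>
      (\<forall>i. \<sigma> (map Y [0..<Suc i]) \<in> Y i \<and> legal (z @ plays \<sigma> Y i) (\<sigma> (map Y [0..<Suc i]))) \<and>
      conc z (\<lambda>i. \<sigma> (map Y [0..<Suc i])) \<in> A"
    by blast
  then have "II_has_strategy_Gowers W z A \<or> I_has_strategy_asymptotic W z (UNIV - A)"
  proof cases
    case 1
    then show ?thesis using I_has_strategy_asymptotic_if_avoids[OF space] by blast
  next
    case (2 \<sigma>)
    have "II_has_strategy_Gowers W z A"
      unfolding II_has_strategy_Gowers_def Let_def
    proof (intro exI[of _ \<sigma>] allI impI)
      fix Y :: "nat \<Rightarrow> 'e set"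
      assume "\<forall>i. block_subspace (Y i) \<and> Y i \<subseteq> W"
      note run = 2[OF this]
      \<comment> \<open>The move of round \<open>i + 1\<close> is legal after a position that ends
        in the move of round \<open>i\<close>, so consecutive moves increase.\<close>
      have "last (z @ plays \<sigma> Y (Suc i)) = \<sigma> (map Y [0..<Suc i])" for i
        by (simp add: plays_def)
      moreover have "z @ plays \<sigma> Y (Suc i) \<noteq> []" for i by (simp add: plays_def)
      ultimately have "vec_less (\<sigma> (map Y [0..<Suc i])) (\<sigma> (map Y [0..<Suc (Suc i)]))" for i
        using run unfolding legal_def by metis
      then show "(\<forall>i. \<sigma> (map Y [0..<Suc i]) \<noteq> 0 \<and> \<sigma> (map Y [0..<Suc i]) \<in> Y i \<and>
          vec_less (\<sigma> (map Y [0..<Suc i])) (\<sigma> (map Y [0..<Suc (Suc i)]))) \<and>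
        conc z (\<lambda>i. \<sigma> (map Y [0..<Suc i])) \<in> A"
        using run unfolding legal_def by blast
    qed
    then show ?thesis by blast
  qed
  then show "\<exists>W. block_subspace W \<and> W \<subseteq> V \<and>
      (II_has_strategy_Gowers W z A \<or> I_has_strategy_asymptotic W z (UNIV - A))"
    using W by blast
qed

end

theorem theorem5:
  fixes scale :: "'f::field \<Rightarrow> 'e::ab_group_add \<Rightarrow> 'e"
    and e :: "nat \<Rightarrow> 'e"
    and A :: "(nat \<Rightarrow> 'e) set"
  assumes "countable (UNIV :: 'f set)"
    and "vector_space_with_basis scale e"
    and "analytic_set_in discrete_sequence_space A"
  shows "vector_space_with_basis.strategically_Ramsey scale e A"
  using vector_space_with_basis.analytic_strategically_Ramsey[OF assms(2,1,3)] .

end
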